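(* Let $\theta^\star\in\mathbb R^d\setminus\{0\}$, let $m$ be a positive integer, and suppose $\sigma^\star\in\mathcal F^0_{\rm link}$ satisfies $\sigma^\star(t)>0$ for all $t>0$. For any $\bar\theta\in\mathbb R^d\setminus\{0\}$ such that $\bar\theta/\|\bar\theta\|_2=\theta^\star/\|\theta^\star\|_2$ and any positive integer $\bar m$, there is another link function $\bar\sigma\in\mathcal F^0_{\rm link}$ such that the distributions $$\mathbb P^{\sigma^\star,\theta^\star,m}_{(X,Y^+)}\quad\text{and}\quad\mathbb P^{\bar\sigma,\bar\theta,\bar m}_{(X,Y^+)}$$ are equal.
   Context: $\mathcal F^0_{\rm link}$ is the set of functions $\sigma:\mathbb R\to[0,1]$ with $\sigma(0)=\frac12$, $\mathrm{sign}(\sigma(t)-\frac12)=\mathrm{sign}(t)$ for all $t$ (with $\mathrm{sign}(0)=0$), and $\sigma(t)+\sigma(-t)=1$ for all $t$. For $\sigma\in\mathcal F^0_{\rm link}$, $\theta\in\mathbb R^d$ and $m\in\mathbb N$, $\mathbb P^{\sigma,\theta,m}_{(X,Y^+)}$ is the law of $(X,Y^+)$ generated as follows: $X\sim\mathsf N(0,I_d)$; given $X=x$, labels $Y_1,\dots,Y_m\in\{-1,1\}$ are i.i.d. with $\mathbb P(Y_j=y\mid X=x)=\sigma(y\langle\theta,x\rangle)$; $Y^+$ is the majority value of $Y_1,\dots,Y_m$, ties broken uniformly at random. *)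

theory Defs
  imports "HOL-Probability.Probability"
begin

(* Borel measurability is needed for the sampling scheme below to define a law at all. *)
definition F_link0 :: "(real \<Rightarrow> real) set" where
  "F_link0 = {\<sigma>. \<sigma> \<in> borel_measurable borel \<and>
     (\<forall>t. 0 \<le> \<sigma> t \<and> \<sigma> t \<le> 1) \<and>
     \<sigma> 0 = 1 / 2 \<and>
     (\<forall>t. sgn (\<sigma> t - 1 / 2) = sgn t) \<and>
     (\<forall>t. \<sigma> t + \<sigma> (- t) = 1)}"

definition std_gaussian :: "(real ^ 'n) measure" where
  "std_gaussian = density lborel (\<lambda>x. ennreal (\<Prod>i\<in>UNIV. std_normal_density (x $ i)))"

(* For \<sigma> in F_link0 the embedded function is a probability mass function; see pmf_label_pmf. *)
definition label_pmf :: "(real \<Rightarrow> real) \<Rightarrow> real \<Rightarrow> int pmf" where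
  "label_pmf \<sigma> t = embed_pmf (\<lambda>y. if y \<in> {-1, 1} then \<sigma> (of_int y * t) else 0)"

definition majority_pmf :: "int list \<Rightarrow> int pmf" where
  "majority_pmf ys =
     (if count_list ys (-1) < count_list ys 1 then return_pmf 1
      else if count_list ys 1 < count_list ys (-1) then return_pmf (-1)
      else pmf_of_set {-1, 1})"

definition majority_label_pmf :: "(real \<Rightarrow> real) \<Rightarrow> nat \<Rightarrow> real \<Rightarrow> int pmf" where
  "majority_label_pmf \<sigma> m t = bind_pmf (replicate_pmf m (label_pmf \<sigma> t)) majority_pmf"

definition law_XY :: "(real \<Rightarrow> real) \<Rightarrow> real ^ 'n \<Rightarrow> nat \<Rightarrow> ((real ^ 'n) \<times> int) measure" where
  "law_XY \<sigma> \<theta> m =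
     std_gaussian \<bind> (\<lambda>x. distr (measure_pmf (majority_label_pmf \<sigma> m (\<theta> \<bullet> x)))
                             (borel \<Otimes>\<^sub>M count_space UNIV) (\<lambda>y. (x, y)))"


lemma sets_std_gaussian [simp, measurable_cong]: "sets std_gaussian = sets borel"
  by (simp add: std_gaussian_def)

lemma space_std_gaussian [simp]: "space std_gaussian = UNIV"
  by (simp add: std_gaussian_def)

lemma prob_space_std_gaussian: "prob_space (std_gaussian :: (real ^ 'n) measure)"
proof
  have one: "(\<integral>\<^sup>+t. ennreal (std_normal_density t) \<partial>lborel) = 1"
    using prob_space.emeasure_space_1[OF prob_space_normal_density[of 1 0]]
    by (simp add: emeasure_density)
  have basis: "(\<Prod>i\<in>UNIV. ennreal (std_normal_density (x $ i)))
      = (\<Prod>b\<in>Basis. ennreal (std_normal_density (x \<bullet> b)))" for x :: "real ^ 'n"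
  proof -
    have B: "(Basis :: (real ^ 'n) set) = range (\<lambda>i. axis i 1)"
      by (auto simp: Basis_vec_def)
    have "inj (\<lambda>i :: 'n. axis i (1 :: real))"
      by (auto simp: inj_def axis_eq_axis)
    then show ?thesis
      unfolding B by (subst prod.reindex) (auto simp: inner_axis)
  qed
  have "emeasure (std_gaussian :: (real ^ 'n) measure) (space std_gaussian)
      = (\<integral>\<^sup>+x. (\<Prod>b\<in>Basis. ennreal (std_normal_density (x \<bullet> b)))
            \<partial>(lborel :: (real ^ 'n) measure))"
    by (simp add: std_gaussian_def emeasure_density basis prod_ennreal[symmetric])
  also have "\<dots> = (\<Prod>b\<in>(Basis :: (real ^ 'n) set). \<integral>\<^sup>+t. ennreal (std_normal_density t) \<partial>lborel)"
    by (rule nn_integral_lborel_prod) auto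
  also have "\<dots> = 1"
    by (simp add: one)
  finally show "emeasure (std_gaussian :: (real ^ 'n) measure) (space std_gaussian) = 1" .
qed

lemma pmf_label_pmf:
  assumes "\<sigma> \<in> F_link0"
  shows "pmf (label_pmf \<sigma> t) y = (if y \<in> {-1, 1} then \<sigma> (of_int y * t) else 0)"
  unfolding label_pmf_def
proof (rule pmf_embed_pmf)
  have s: "\<sigma> s \<ge> 0" "\<sigma> s + \<sigma> (- s) = 1" for s
    using assms by (auto simp: F_link0_def)
  show "0 \<le> (if y \<in> {-1, 1} then \<sigma> (of_int y * t) else 0)" for y :: int
    using s by simp
  have "(\<integral>\<^sup>+y. ennreal (if y \<in> {-1, 1} then \<sigma> (of_int y * t) else 0) \<partial>count_space (UNIV :: int set))
      = (\<Sum>y\<in>{-1, 1 :: int}. ennreal (if y \<in> {-1, 1} then \<sigma> (of_int y * t) else 0))"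
    by (rule nn_integral_count_space') auto
  also have "\<dots> = 1"
    using s[of t] s(1)[of "- t"]
    by (simp add: ennreal_plus[symmetric] add.commute del: ennreal_plus)
  finally show "(\<integral>\<^sup>+y. ennreal (if y \<in> {-1, 1} then \<sigma> (of_int y * t) else 0) \<partial>count_space (UNIV :: int set)) = 1" .
qed

lemma measurable_label_pmf:
  assumes \<sigma>: "\<sigma> \<in> F_link0"
  shows "(\<lambda>t. measure_pmf (label_pmf \<sigma> t)) \<in> borel \<rightarrow>\<^sub>M prob_algebra (count_space UNIV)"
proof (intro measurable_prob_algebraI measurable_subprob_algebra)
  have [measurable]: "\<sigma> \<in> borel_measurable borel"
    using \<sigma> by (auto simp: F_link0_def)
  fix A :: "int set"
  have "emeasure (measure_pmf (label_pmf \<sigma> t)) A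
      = (\<Sum>y\<in>{-1, 1}. ennreal (\<sigma> (of_int y * t)) * indicator A y)" for t
  proof -
    have "emeasure (measure_pmf (label_pmf \<sigma> t)) A
        = (\<integral>\<^sup>+y. ennreal (pmf (label_pmf \<sigma> t) y) * indicator A y \<partial>count_space UNIV)"
      by (simp add: nn_integral_measure_pmf[symmetric])
    also have "\<dots> = (\<Sum>y\<in>{-1, 1}. ennreal (pmf (label_pmf \<sigma> t) y) * indicator A y)"
      by (rule nn_integral_count_space') (auto simp: pmf_label_pmf[OF \<sigma>])
    finally show ?thesis
      by (simp add: pmf_label_pmf[OF \<sigma>])
  qed
  then show "(\<lambda>t. emeasure (measure_pmf (label_pmf \<sigma> t)) A) \<in> borel_measurable borel"
    by simp
qed (auto intro: measure_pmf.prob_space_axioms prob_space_imp_subprob_space)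

lemma measurable_count_space_prob_algebra:
  "(\<lambda>x. measure_pmf (p x)) \<in> count_space UNIV \<rightarrow>\<^sub>M prob_algebra (count_space UNIV)"
  by (intro measurable_prob_algebraI measurable_measure_pmf measure_pmf.prob_space_axioms)

lemma measurable_replicate_pmf:
  fixes p :: "'a \<Rightarrow> 'b :: countable pmf"
  assumes p [measurable]: "(\<lambda>t. measure_pmf (p t)) \<in> M \<rightarrow>\<^sub>M prob_algebra (count_space UNIV)"
  shows "(\<lambda>t. measure_pmf (replicate_pmf n (p t))) \<in> M \<rightarrow>\<^sub>M prob_algebra (count_space UNIV)"
proof (induction n)
  case 0
  show ?case
    by (auto intro!: measurable_const simp: space_prob_algebra measure_pmf.prob_space_axioms)
next
  case (Suc n)
  note [measurable] = Suc
  have "measure_pmf (replicate_pmf (Suc n) (p t)) =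
      measure_pmf (p t) \<bind> (\<lambda>x. distr (measure_pmf (replicate_pmf n (p t)))
        (count_space UNIV) (\<lambda>xs. x # xs))" for t
    by (simp add: measure_pmf_bind map_pmf_def[symmetric] map_pmf_rep_eq)
  then show ?case
    by simp
qed

lemma measurable_majority_label_pmf:
  assumes "\<sigma> \<in> F_link0"
  shows "(\<lambda>t. measure_pmf (majority_label_pmf \<sigma> m t)) \<in> borel \<rightarrow>\<^sub>M prob_algebra (count_space UNIV)"
  unfolding majority_label_pmf_def measure_pmf_bind
  by (rule measurable_bind_prob_space[OF measurable_replicate_pmf[OF measurable_label_pmf[OF assms]]
        measurable_count_space_prob_algebra])

lemma measurable_law_XY_kernel:
  fixes \<theta> :: "real ^ 'n"
  assumes "\<sigma> \<in> F_link0"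
  shows "(\<lambda>x. distr (measure_pmf (majority_label_pmf \<sigma> m (\<theta> \<bullet> x)))
            (borel \<Otimes>\<^sub>M count_space UNIV) (\<lambda>y. (x, y)))
          \<in> borel \<rightarrow>\<^sub>M prob_algebra (borel \<Otimes>\<^sub>M count_space UNIV)"
proof -
  have [measurable]: "(\<lambda>x. measure_pmf (majority_label_pmf \<sigma> m (\<theta> \<bullet> x)))
      \<in> borel \<rightarrow>\<^sub>M prob_algebra (count_space UNIV)"
    by (rule measurable_compose[OF _ measurable_majority_label_pmf[OF assms]]) measurable
  show ?thesis
    by measurable
qed

lemma
  fixes \<theta> :: "real ^ 'n"
  assumes "\<sigma> \<in> F_link0"
  shows prob_space_law_XY: "prob_space (law_XY \<sigma> \<theta> m)"
    and sets_law_XY: "sets (law_XY \<sigma> \<theta> m) = sets (borel \<Otimes>\<^sub>M count_space UNIV)"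
proof -
  have g: "(std_gaussian :: (real ^ 'n) measure) \<in> space (prob_algebra borel)"
    by (simp add: space_prob_algebra prob_space_std_gaussian)
  show "prob_space (law_XY \<sigma> \<theta> m)"
    unfolding law_XY_def by (rule prob_space_bind'[OF g measurable_law_XY_kernel[OF assms]])
  show "sets (law_XY \<sigma> \<theta> m) = sets (borel \<Otimes>\<^sub>M count_space UNIV)"
    unfolding law_XY_def by (rule sets_bind'[OF g measurable_law_XY_kernel[OF assms]])
qed

lemma emeasure_law_XY:
  fixes \<theta> :: "real ^ 'n"
  assumes \<sigma>: "\<sigma> \<in> F_link0" and A: "A \<in> sets borel"
  shows "emeasure (law_XY \<sigma> \<theta> m) (A \<times> {y}) =
    (\<integral>\<^sup>+x\<in>A. ennreal (pmf (majority_label_pmf \<sigma> m (\<theta> \<bullet> x)) y) \<partial>std_gaussian)"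
proof -
  have K: "(\<lambda>x. distr (measure_pmf (majority_label_pmf \<sigma> m (\<theta> \<bullet> x)))
            (borel \<Otimes>\<^sub>M count_space UNIV) (\<lambda>y. (x, y)))
          \<in> std_gaussian \<rightarrow>\<^sub>M subprob_algebra (borel \<Otimes>\<^sub>M count_space UNIV)"
    using measurable_prob_algebraD[OF measurable_law_XY_kernel[OF \<sigma>, of m \<theta>]]
    by (simp cong: measurable_cong_sets)
  have AY: "A \<times> {y} \<in> sets (borel \<Otimes>\<^sub>M count_space UNIV)"
    using A by auto
  have sec: "Pair x -` (A \<times> {y}) = (if x \<in> A then {y} else {})" for x :: "real ^ 'n"
    by auto
  have Px: "Pair x \<in> measure_pmf p \<rightarrow>\<^sub>M borel \<Otimes>\<^sub>M count_space UNIV" for x :: "real ^ 'n" and p :: "int pmf"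
    by (simp add: space_pair_measure)
  have "emeasure (distr (measure_pmf p) (borel \<Otimes>\<^sub>M count_space UNIV) (Pair x)) (A \<times> {y})
      = ennreal (pmf p y) * indicator A x" for x :: "real ^ 'n" and p
    by (simp add: emeasure_distr[OF Px AY] sec emeasure_pmf_single)
  then show ?thesis
    unfolding law_XY_def by (subst emeasure_bind[OF _ K AY]) auto
qed

end

theory Submission
  imports Defs
begin

text \<open>
  Let \<open>h\<^sub>m(p)\<close> be the probability that the majority of \<open>m\<close> independent labels, each positive with
  probability \<open>p\<close>, is positive. For \<open>m > 0\<close> it is an increasing homeomorphism of \<open>[0, 1]\<close> with
  \<open>h\<^sub>m(p) + h\<^sub>m(1 - p) = 1\<close>. Writing \<open>\<theta>\<^sup>\<star> = c \<theta>\<close> with \<open>c > 0\<close>, the link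
  \<open>\<sigma>(t) = h\<^sub>n\<^sup>-\<^sup>1 (h\<^sub>m (\<sigma>\<^sup>\<star>(c t)))\<close> aggregated over \<open>n\<close> labels
  gives the same conditional law of the majority given \<open>x\<close> as \<open>\<sigma>\<^sup>\<star>\<close> over \<open>m\<close> labels.
\<close>

section \<open>Majority probability through the running lead\<close>

text \<open>\<open>maj_prob n d p\<close> is the probability of a positive majority when the positive labels
  lead by \<open>d\<close> and \<open>n\<close> further labels are to be drawn.\<close>

fun maj_prob :: "nat \<Rightarrow> int \<Rightarrow> real \<Rightarrow> real" where
  "maj_prob 0 d p = (1 + of_int (sgn d)) / 2"
| "maj_prob (Suc n) d p = p * maj_prob n (d + 1) p + (1 - p) * maj_prob n (d - 1) p"

lemma continuous_on_maj_prob: "continuous_on S (maj_prob n d)"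
proof -
  have "continuous_on S (\<lambda>p. maj_prob n d p)"
    by (induction n arbitrary: d) (auto intro!: continuous_intros)
  then show ?thesis by simp
qed

lemma maj_prob_1_right: "maj_prob n d 1 = (1 + of_int (sgn (d + int n))) / 2"
  by (induction n arbitrary: d) (auto simp: algebra_simps)

text \<open>Swapping the two labels negates the lead and exchanges \<open>p\<close> with
  \<open>1 - p\<close>. The tie value 1/2 is its own complement, so the base case respects the
  swap.\<close>

lemma maj_prob_reflect: "maj_prob n (- d) (1 - p) = 1 - maj_prob n d p"
proof (induction n arbitrary: d)
  case 0
  show ?case by (simp add: field_simps)
next
  case (Suc n)
  have "maj_prob n (- d + 1) (1 - p) = 1 - maj_prob n (d - 1) p"
    "maj_prob n (- d - 1) (1 - p) = 1 - maj_prob n (d + 1) p"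
    using Suc[of "d - 1"] Suc[of "d + 1"] by simp_all
  then show ?case
    unfolding maj_prob.simps by (simp only:) (simp add: algebra_simps)
qed

section \<open>Monotonicity in the lead and in the label probability\<close>

lemma maj_prob_mono_lead:
  assumes "0 \<le> p" "p \<le> 1" "d \<le> e"
  shows "maj_prob n d p \<le> maj_prob n e p"
  using assms(3)
proof (induction n arbitrary: d e)
  case 0
  then show ?case by (auto simp: sgn_if)
next
  case (Suc n)
  show ?case
    using assms Suc by (auto intro!: add_mono mult_left_mono)
qed

text \<open>The bound on \<open>d\<close> means that some run of \<open>n\<close> labels brings the
  middle lead \<open>d\<close> to -1, 0 or 1, exactly where the leads one below and one above differ
  in sign. Such a run has positive probability because \<open>0 < p < 1\<close>.\<close>

lemma maj_prob_strict_lead: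
  assumes "0 < p" "p < 1" "\<bar>d\<bar> \<le> int n + 1"
  shows "maj_prob n (d - 1) p < maj_prob n (d + 1) p"
  using assms(3)
proof (induction n arbitrary: d)
  case 0
  then have "d = -1 \<or> d = 0 \<or> d = 1" by auto
  then show ?case by auto
next
  case (Suc n)
  have le: "maj_prob n d p \<le> maj_prob n (d + 2) p" "maj_prob n (d - 2) p \<le> maj_prob n d p"
    using assms by (auto intro!: maj_prob_mono_lead)
  \<comment> \<open>One outcome of the next label keeps the middle lead within the range allowed for
    the \<open>n\<close> labels that remain.\<close>
  consider "\<bar>d + 1\<bar> \<le> int n + 1" | "\<bar>d - 1\<bar> \<le> int n + 1"
    using Suc.prems by linarith
  then have lt: "maj_prob n d p < maj_prob n (d + 2) p \<or> maj_prob n (d - 2) p < maj_prob n d p"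
    using Suc.IH[of "d + 1"] Suc.IH[of "d - 1"] by cases (auto simp: algebra_simps)
  have "p * maj_prob n d p + (1 - p) * maj_prob n (d - 2) p
      < p * maj_prob n (d + 2) p + (1 - p) * maj_prob n d p"
    using lt
  proof
    assume "maj_prob n d p < maj_prob n (d + 2) p"
    then show ?thesis
      using assms le by (intro add_less_le_mono mult_strict_left_mono mult_left_mono) auto
  next
    assume "maj_prob n (d - 2) p < maj_prob n d p"
    then show ?thesis
      using assms le by (intro add_le_less_mono mult_strict_left_mono mult_left_mono) auto
  qed
  then show ?case by (simp add: algebra_simps)
qed

text \<open>Pass from \<open>p\<close> to \<open>q\<close> in two stages: first in the last
  \<open>n\<close> labels, then in the weight of the first label. The second stage contributes
  exactly the subtracted product.\<close>

lemma maj_prob_Suc_mono_weight: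
  assumes "maj_prob n (d + 1) p \<le> maj_prob n (d + 1) q" "maj_prob n (d - 1) p \<le> maj_prob n (d - 1) q"
    and "0 \<le> p" "p \<le> 1"
  shows "maj_prob (Suc n) d p
    \<le> maj_prob (Suc n) d q - (q - p) * (maj_prob n (d + 1) q - maj_prob n (d - 1) q)"
proof -
  have "maj_prob (Suc n) d p \<le> p * maj_prob n (d + 1) q + (1 - p) * maj_prob n (d - 1) q"
    using assms by (auto intro!: add_mono mult_left_mono)
  then show ?thesis by (simp add: algebra_simps)
qed

lemma maj_prob_mono:
  assumes "0 \<le> p" "p \<le> q" "q \<le> 1"
  shows "maj_prob n d p \<le> maj_prob n d q"
proof (induction n arbitrary: d)
  case 0
  show ?case by simp
next
  case (Suc n)
  have "0 \<le> (q - p) * (maj_prob n (d + 1) q - maj_prob n (d - 1) q)"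
    using assms by (auto intro!: mult_nonneg_nonneg maj_prob_mono_lead)
  moreover have "maj_prob (Suc n) d p
      \<le> maj_prob (Suc n) d q - (q - p) * (maj_prob n (d + 1) q - maj_prob n (d - 1) q)"
    using assms by (intro maj_prob_Suc_mono_weight Suc) auto
  ultimately show ?case by linarith
qed

lemma maj_prob_strict_mono:
  assumes "n > 0" "0 \<le> p" "p < q" "q \<le> 1"
  shows "maj_prob n 0 p < maj_prob n 0 q"
proof -
  obtain k where n: "n = Suc k" using assms(1) gr0_implies_Suc by blast
  \<comment> \<open>Strictness in the lead needs a probability inside the open interval, but
    \<open>q\<close> may be 1. The strict gain is therefore collected at the midpoint.\<close>
  define r where "r = (p + q) / 2"
  have r: "p < r" "r < q" "0 < r" "r < 1" using assms by (auto simp: r_def)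
  have "0 < (r - p) * (maj_prob k (0 + 1) r - maj_prob k (0 - 1) r)"
    using maj_prob_strict_lead[of r 0 k] r by simp
  moreover have "maj_prob n 0 p
      \<le> maj_prob n 0 r - (r - p) * (maj_prob k (0 + 1) r - maj_prob k (0 - 1) r)"
    unfolding n by (rule maj_prob_Suc_mono_weight) (use r assms in \<open>auto intro: maj_prob_mono\<close>)
  moreover have "maj_prob n 0 r \<le> maj_prob n 0 q"
    using r assms by (intro maj_prob_mono) auto
  ultimately show ?thesis by linarith
qed

section \<open>A symmetric bijection of the unit interval\<close>

lemma maj_prob_less_iff:
  assumes "n > 0" "p \<in> {0..1}" "q \<in> {0..1}"
  shows "maj_prob n 0 p < maj_prob n 0 q \<longleftrightarrow> p < q"
  using maj_prob_strict_mono[of n p q] maj_prob_mono[of q p n 0] assms by (meson atLeastAtMost_iff linorder_not_le)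

lemma maj_prob_complement: "maj_prob n 0 (1 - p) = 1 - maj_prob n 0 p"
  using maj_prob_reflect[of n 0 p] by simp

lemma maj_prob_half: "maj_prob n 0 (1 / 2) = 1 / 2"
  using maj_prob_complement[of n "1 / 2"] by simp

lemma sgn_maj_prob:
  assumes "n > 0" "p \<in> {0..1}"
  shows "sgn (maj_prob n 0 p - 1 / 2) = sgn (p - 1 / 2)"
  using maj_prob_less_iff[OF assms, of "1 / 2"] maj_prob_less_iff[OF assms(1) _ assms(2), of "1 / 2"]
  by (auto simp: maj_prob_half sgn_if)

lemma inj_on_maj_prob:
  assumes "n > 0"
  shows "inj_on (maj_prob n 0) {0..1}"
  by (intro inj_onI) (metis assms less_irrefl linorder_neqE_linordered_idom maj_prob_less_iff)

text \<open>Both endpoints are fixed, so the intermediate value theorem gives surjectivity and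
  monotonicity confines the values.\<close>

lemma maj_prob_image:
  assumes "n > 0"
  shows "maj_prob n 0 ` {0..1} = {0..1}"
proof -
  have 1: "maj_prob n 0 1 = 1" using assms by (simp add: maj_prob_1_right)
  then have 0: "maj_prob n 0 0 = 0" using maj_prob_complement[of n 1] by simp
  have "y \<in> maj_prob n 0 ` {0..1}" if "y \<in> {0..1}" for y
    using IVT'[of "maj_prob n 0" 0 y 1] that 0 1 continuous_on_maj_prob by force
  moreover have "maj_prob n 0 p \<in> {0..1}" if "p \<in> {0..1}" for p
    using maj_prob_mono[of 0 p n 0] maj_prob_mono[of p 1 n 0] that 0 1 by auto
  ultimately show ?thesis by blast
qed

section \<open>From lists of labels to the majority probability\<close>

lemma majority_pmf_positive:
  "pmf (majority_pmf ys) 1 = maj_prob 0 (int (count_list ys 1) - int (count_list ys (-1))) p"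
  by (auto simp: majority_pmf_def sgn_if)

text \<open>The prefix \<open>zs\<close> holds the labels already drawn. Generalising over it lets
  each draw shift the lead, matching the recursion of \<open>maj_prob\<close>.\<close>

lemma replicate_majority_positive:
  fixes P :: "int pmf"
  assumes P: "set_pmf P \<subseteq> {-1, 1}"
  shows "pmf (bind_pmf (replicate_pmf n P) (\<lambda>ys. majority_pmf (zs @ ys))) 1
    = maj_prob n (int (count_list zs 1) - int (count_list zs (-1))) (pmf P 1)"
proof (induction n arbitrary: zs)
  case 0
  show ?case using majority_pmf_positive by (simp add: bind_return_pmf)
next
  case (Suc n)
  have "pmf P (-1) + pmf P 1 = 1"
    using sum_pmf_eq_1[OF _ P] by simp
  then have m1: "pmf P (-1) = 1 - pmf P 1" by simp
  have "bind_pmf (replicate_pmf (Suc n) P) (\<lambda>ys. majority_pmf (zs @ ys))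
     = bind_pmf P (\<lambda>y. bind_pmf (replicate_pmf n P) (\<lambda>ys. majority_pmf ((zs @ [y]) @ ys)))"
    by (simp add: bind_assoc_pmf bind_return_pmf)
  then have "pmf (bind_pmf (replicate_pmf (Suc n) P) (\<lambda>ys. majority_pmf (zs @ ys))) 1
     = (\<Sum>y\<in>{-1, 1}. pmf P y *
          pmf (bind_pmf (replicate_pmf n P) (\<lambda>ys. majority_pmf ((zs @ [y]) @ ys))) 1)"
    using P by (simp only: pmf_bind[of P]) (subst integral_measure_pmf[of "{-1, 1}"], auto)
  also have "\<dots> = maj_prob (Suc n) (int (count_list zs 1) - int (count_list zs (-1))) (pmf P 1)"
    unfolding Suc by (simp add: m1 algebra_simps)
  finally show ?case .
qed

lemma pmf_majority_label_pmf:
  assumes "\<sigma> \<in> F_link0"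
  shows "pmf (majority_label_pmf \<sigma> m t) 1 = maj_prob m 0 (\<sigma> t)"
proof -
  have "set_pmf (label_pmf \<sigma> t) \<subseteq> {-1, 1}"
    by (auto simp: set_pmf_iff pmf_label_pmf[OF assms] split: if_splits)
  from replicate_majority_positive[OF this, of m "[]"] show ?thesis
    by (simp add: majority_label_pmf_def pmf_label_pmf[OF assms])
qed

lemma set_majority_label_pmf: "set_pmf (majority_label_pmf \<sigma> m t) \<subseteq> {-1, 1}"
  by (auto simp: majority_label_pmf_def majority_pmf_def split: if_splits)

lemma pmf_eqI_two_points:
  assumes "set_pmf P \<subseteq> {a, b}" "set_pmf Q \<subseteq> {a, b}" "a \<noteq> b" "pmf P b = pmf Q b"
  shows "P = Q"
proof (rule pmf_eqI)
  fix y
  have "pmf P a + pmf P b = 1" "pmf Q a + pmf Q b = 1"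
    using sum_pmf_eq_1[OF _ assms(1)] sum_pmf_eq_1[OF _ assms(2)] assms(3) by simp_all
  moreover have "pmf P y = 0" "pmf Q y = 0" if "y \<notin> {a, b}"
    using that assms(1,2) by (auto simp: set_pmf_iff)
  ultimately show "pmf P y = pmf Q y"
    using assms(4) by (cases "y \<in> {a, b}") auto
qed

text \<open>The majority takes only the values -1 and 1, so its conditional law given
  \<open>x\<close> is fixed by its mass at 1; equal kernels give equal joint laws.\<close>

lemma law_XY_cong:
  fixes \<theta> \<theta>' :: "real ^ 'n"
  assumes "\<sigma> \<in> F_link0" "\<sigma>' \<in> F_link0"
    and "\<And>x. maj_prob m 0 (\<sigma> (\<theta> \<bullet> x)) = maj_prob m' 0 (\<sigma>' (\<theta>' \<bullet> x))"
  shows "law_XY \<sigma> \<theta> m = law_XY \<sigma>' \<theta>' m'"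
proof -
  have "majority_label_pmf \<sigma> m (\<theta> \<bullet> x) = majority_label_pmf \<sigma>' m' (\<theta>' \<bullet> x)" for x
    using assms
    by (intro pmf_eqI_two_points[OF set_majority_label_pmf set_majority_label_pmf])
       (auto simp: pmf_majority_label_pmf)
  then show ?thesis by (simp add: law_XY_def)
qed

section \<open>Construction of the new link\<close>

text \<open>The inverse of \<open>maj_prob n 0\<close> is continuous by compactness of \<open>{0..1}\<close>, which makes the
  reparametrised link measurable.\<close>

lemma ex_link_maj_prob_eq:
  assumes n: "n > 0" and m: "m > 0" and c: "c > 0" and \<sigma>: "\<sigma> \<in> F_link0"
  shows "\<exists>\<sigma>' \<in> F_link0. \<forall>t. maj_prob n 0 (\<sigma>' t) = maj_prob m 0 (\<sigma> (c * t))"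
proof -
  have meas [measurable]: "\<sigma> \<in> borel_measurable borel"
    and range: "\<sigma> t \<in> {0..1}"
    and sgn: "sgn (\<sigma> t - 1 / 2) = sgn t"
    and sym: "\<sigma> (- t) = 1 - \<sigma> t" for t
    using \<sigma> by (auto simp: F_link0_def algebra_simps)
  define g where "g = the_inv_into {0..1} (maj_prob n 0)"
  define f where "f t = maj_prob m 0 (\<sigma> (c * t))" for t
  have f_range: "f t \<in> {0..1}" for t
    using range maj_prob_image[OF m] by (auto simp: f_def)
  have g_range: "g (f t) \<in> {0..1}" for t
    unfolding g_def using f_range
    by (intro the_inv_into_into inj_on_maj_prob n) (auto simp: maj_prob_image[OF n])
  have eq: "maj_prob n 0 (g (f t)) = f t" for t
    unfolding g_def using f_range
    by (intro f_the_inv_into_f inj_on_maj_prob n) (simp add: maj_prob_image[OF n])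
  have "continuous_on {0..1} g"
    using continuous_on_inv[of "{0..1}" "maj_prob n 0" g] inj_on_maj_prob[OF n]
    by (auto simp: maj_prob_image[OF n] g_def continuous_on_maj_prob the_inv_into_f_f)
  then have "g \<in> borel_measurable (restrict_space borel {0..1})"
    by (rule borel_measurable_continuous_on_restrict)
  moreover have "f \<in> borel_measurable borel"
    unfolding f_def using borel_measurable_continuous_onI[OF continuous_on_maj_prob]
    by measurable
  \<comment> \<open>Measurability of \<open>g\<close> is established on the unit interval, so
    \<open>f\<close> is given that target before composing.\<close>
  then have "f \<in> borel \<rightarrow>\<^sub>M restrict_space borel {0..1}"
    using f_range by (intro measurable_restrict_space2) auto
  ultimately have "(\<lambda>t. g (f t)) \<in> borel_measurable borel"
    by (rule measurable_compose[rotated])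
  moreover have sgn': "sgn (g (f t) - 1 / 2) = sgn t" for t
  proof -
    have "sgn (g (f t) - 1 / 2) = sgn (f t - 1 / 2)"
      using sgn_maj_prob[OF n g_range] by (simp add: eq)
    also have "\<dots> = sgn t"
      using c by (simp add: f_def sgn_maj_prob[OF m range] sgn sgn_mult)
    finally show ?thesis .
  qed
  moreover have "g (f 0) = 1 / 2"
    using sgn'[of 0] by (simp add: sgn_0_0)
  moreover have "g (f t) + g (f (- t)) = 1" for t
  proof -
    \<comment> \<open>By injectivity of \<open>maj_prob n 0\<close>, the symmetry of the new link
      follows from equality of images.\<close>
    have "maj_prob n 0 (g (f (- t))) = maj_prob n 0 (1 - g (f t))"
      by (simp add: maj_prob_complement eq) (simp add: f_def sym maj_prob_complement)
    then have "g (f (- t)) = 1 - g (f t)"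
      using inj_onD[OF inj_on_maj_prob[OF n]] g_range[of t] g_range[of "- t"] by auto
    then show ?thesis by simp
  qed
  ultimately have "(\<lambda>t. g (f t)) \<in> F_link0"
    using g_range by (auto simp: F_link0_def)
  then show ?thesis
    using eq by (intro bexI[of _ "\<lambda>t. g (f t)"]) (auto simp: f_def)
qed

theorem proposition4:
  fixes \<theta>_star \<theta>_bar :: "real ^ 'n"
    and \<sigma>_star :: "real \<Rightarrow> real"
    and m m_bar :: nat
  assumes "\<theta>_star \<noteq> 0"
    and "m > 0"
    and "\<sigma>_star \<in> F_link0"
    and "\<And>t. t > 0 \<Longrightarrow> \<sigma>_star t > 0"
    and "\<theta>_bar \<noteq> 0"
    and "\<theta>_bar /\<^sub>R norm \<theta>_bar = \<theta>_star /\<^sub>R norm \<theta>_star"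
    and "m_bar > 0"
  shows "\<exists>\<sigma>_bar \<in> F_link0. law_XY \<sigma>_star \<theta>_star m = law_XY \<sigma>_bar \<theta>_bar m_bar"
proof -
  define c where "c = norm \<theta>_star / norm \<theta>_bar"
  have c: "c > 0" using assms by (simp add: c_def)
  \<comment> \<open>Each parameter is its norm times the common unit vector, so the scale is the
    ratio of the norms.\<close>
  have "\<theta>_star = norm \<theta>_star *\<^sub>R (\<theta>_star /\<^sub>R norm \<theta>_star)"
    using assms(1) by simp
  also have "\<dots> = c *\<^sub>R \<theta>_bar"
    unfolding assms(6)[symmetric] by (simp add: c_def divide_inverse)
  finally have \<theta>: "\<theta>_star = c *\<^sub>R \<theta>_bar" .
  obtain \<sigma>_bar where \<sigma>: "\<sigma>_bar \<in> F_link0"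
    and eq: "\<And>t. maj_prob m_bar 0 (\<sigma>_bar t) = maj_prob m 0 (\<sigma>_star (c * t))"
    using ex_link_maj_prob_eq[OF assms(7,2) c assms(3)] by blast
  have "law_XY \<sigma>_star \<theta>_star m = law_XY \<sigma>_bar \<theta>_bar m_bar"
    by (rule law_XY_cong[OF assms(3) \<sigma>]) (simp add: eq \<theta>)
  with \<sigma> show ?thesis by blast
qed

end
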